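(* Let $\lambda_1,\lambda_2,\lambda_3$ be positive integers. Then the triple $\{\lambda_1,\lambda_2,\lambda_3\}$ occurs as a triangular chord if and only if the following two conditions hold: (1) whenever $\{i,j,k\}=\{1,2,3\}$, $\gcd(\lambda_i,\lambda_j)$ divides $\lambda_k$; (2) if $n=\gcd(\lambda_1,\lambda_2,\lambda_3)$ is even, then $\lambda_i/n$ is even for some $i\in\{1,2,3\}$.
   Context: Work in the upper half-plane model $\mathcal U=\{x+iy\in\mathbb C: y>0\}$ of the hyperbolic plane. A horocycle centered at $x\in\mathbb R$ is a Euclidean circle tangent to $\mathbb R$ at $x$ (with the tangency point removed). The Farey decoration assigns to each rational $p/q$, written in reduced form, the horocycle centered at $p/q$ of Euclidean diameter $1/q^2$. The lambda length of two horocycles $h,h'$ with distinct centers is $\lambda(h,h')=\exp(\delta/2)$, where $\delta$ is the signed hyperbolic distance between $h$ and $h'$ along the geodesic connecting their centers, taken with positive sign if and only if the horocycles are disjoint. The lambda length of the pair of horocycles in the Farey decoration centered at distinct rationals $p/q$ and $r/s$ (in reduced form) equals the positive integer $|ps-qr|$. A triangular chord is an unordered triple (multiset) of the pairwise lambda lengths of the Farey-decoration horocycles centered at three distinct rational numbers $\frac pq<\frac rs<\frac uv$, each written with coprime numerator and denominator and with positive denominator; explicitly, it is the triple $\{qr-ps,\ us-rv,\ uq-pv\}$. *)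

theory Defs
  imports "HOL-Analysis.Analysis" "HOL-Library.Multiset"
begin

section \<open>Horocycles and lambda lengths in the upper half-plane\<close>

definition upper_half_plane :: "complex set" where
  "upper_half_plane = {z. Im z > 0}"

definition hyp_dist :: "complex \<Rightarrow> complex \<Rightarrow> real" where
  "hyp_dist z w = arcosh (1 + (cmod (z - w))\<^sup>2 / (2 * Im z * Im w))"

text \<open>
  The parameter \<open>d\<close> is the Euclidean diameter.  Intersecting with the open half-plane removes
  exactly the point of tangency.
\<close>

definition horocycle :: "real \<Rightarrow> real \<Rightarrow> complex set" where
  "horocycle x d = sphere (Complex x (d / 2)) (d / 2) \<inter> upper_half_plane"

definition horocycle_center :: "complex set \<Rightarrow> real" where
  "horocycle_center h = (THE x. \<exists>d>0. h = horocycle x d)"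

definition geodesic :: "real \<Rightarrow> real \<Rightarrow> complex set" where
  "geodesic x y = sphere (of_real ((x + y) / 2)) (\<bar>x - y\<bar> / 2) \<inter> upper_half_plane"

text \<open>
  A geodesic ending at the center of a horocycle meets that horocycle in exactly one point.
\<close>

definition signed_dist :: "complex set \<Rightarrow> complex set \<Rightarrow> real" where
  "signed_dist h h' =
     (let g = geodesic (horocycle_center h) (horocycle_center h');
          \<delta> = hyp_dist (THE z. z \<in> h \<inter> g) (THE z. z \<in> h' \<inter> g)
      in if h \<inter> h' = {} then \<delta> else - \<delta>)"

definition lambda_length :: "complex set \<Rightarrow> complex set \<Rightarrow> real" where
  "lambda_length h h' = exp (signed_dist h h' / 2)"


section \<open>The Farey decoration and triangular chords\<close>

text \<open>
  \<^const>\<open>quotient_of\<close> yields the reduced fraction with positive denominator.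
\<close>

definition farey_horocycle :: "rat \<Rightarrow> complex set" where
  "farey_horocycle r = horocycle (of_rat r) (1 / (of_int (snd (quotient_of r)))\<^sup>2)"

definition triangular_chord :: "real multiset \<Rightarrow> bool" where
  "triangular_chord M \<longleftrightarrow>
     (\<exists>x y z :: rat. x < y \<and> y < z \<and>
        M = {# lambda_length (farey_horocycle x) (farey_horocycle y),
               lambda_length (farey_horocycle y) (farey_horocycle z),
               lambda_length (farey_horocycle x) (farey_horocycle z) #})"


section \<open>Lambda lengths in the Farey decoration\<close>

lemma mem_horocycle_iff: "d > 0 \<Longrightarrow> z \<in> horocycle x d \<longleftrightarrow> Im z > 0 \<and> (Re z - x)\<^sup>2 + (Im z)\<^sup>2 = d * Im z"
proof -
  assume d: "d>0"
  have "dist (Complex x (d / 2)) z = d/2 \<longleftrightarrow> (dist (Complex x (d / 2)) z)^2 = (d/2)^2"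
    using d by (simp add: power2_eq_iff_nonneg)
  also have "\<dots> \<longleftrightarrow> (Re z - x)\<^sup>2 + (Im z)\<^sup>2 = d * Im z"
    by (simp add: dist_norm cmod_power2) (auto simp: power2_eq_square field_simps)
  finally show ?thesis by (auto simp: horocycle_def upper_half_plane_def)
qed

lemma mem_geodesic_iff: "z \<in> geodesic x y \<longleftrightarrow> Im z > 0 \<and> (Re z - x)*(Re z - y) + (Im z)\<^sup>2 = 0"
proof -
  have "dist (of_real ((x + y) / 2)) z = \<bar>x - y\<bar>/2 \<longleftrightarrow> (dist (of_real ((x + y) / 2)) z)^2 = (\<bar>x - y\<bar>/2)^2"
    by (simp add: power2_eq_iff_nonneg)
  also have "\<dots> \<longleftrightarrow> (Re z - x)*(Re z - y) + (Im z)\<^sup>2 = 0"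
    by (simp add: dist_norm cmod_power2 power_divide) (auto simp: power2_eq_square field_simps)
  finally show ?thesis by (auto simp: geodesic_def upper_half_plane_def)
qed

lemma horocycle_center_unique: assumes "d>0" "e>0" "horocycle x d = horocycle y e" shows "x = y"
proof -
  have a: "Complex x d \<in> horocycle y e" "Complex y e \<in> horocycle x d"
  proof -
    have "Complex x d \<in> horocycle x d" "Complex y e \<in> horocycle y e" using assms(1,2) by (simp_all add: mem_horocycle_iff power2_eq_square)
    then show "Complex x d \<in> horocycle y e" "Complex y e \<in> horocycle x d" using assms(3) by auto
  qed
  then have "(x-y)^2 + d^2 = e*d" "(y-x)^2 + e^2 = d*e" using assms(1,2) a(1)[unfolded mem_horocycle_iff[OF assms(2)]] a(2)[unfolded mem_horocycle_iff[OF assms(1)]] by simp_all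
  then have "2 * (x-y)^2 + (d-e)^2 = 0" by (simp add: power2_eq_square algebra_simps)
  then show ?thesis by (simp add: sum_power2_eq_zero_iff add_nonneg_eq_0_iff)
qed

lemma horocycle_center_horocycle: "d>0 \<Longrightarrow> horocycle_center (horocycle x d) = x"
  unfolding horocycle_center_def by (rule the_equality) (use horocycle_center_unique in blast)+

lemma horocycle_meets_geodesic: assumes "d>0" "x \<noteq> y"
  shows "(THE z. z \<in> horocycle x d \<inter> geodesic x y) = Complex (x + d^2*(y-x)/((y-x)^2+d^2)) (d*(y-x)^2/((y-x)^2+d^2))"
    (is "_ = ?z")
proof (rule the_equality)
  define a where "a = y - x"
  have y: "y = x + a" and a: "a \<noteq> 0" using assms by (auto simp: a_def)
  define s where "s = a^2+d^2"
  have s: "s > 0" using assms by (simp add: s_def add_nonneg_pos)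
  have z: "?z = Complex (x + d^2*a/s) (d*a^2/s)" unfolding y s_def by simp
  have p: "d*a^2/s > 0" using s a assms by simp
  have s2: "a\<^sup>2 = s - d\<^sup>2" unfolding s_def by simp
  have e: "(d^2*a/s)^2 + (d*a^2/s)^2 = d * (d*a^2/s)" 
  proof -
    have "(d^2*a/s)^2 + (d*a^2/s)^2 = d^2*a^2*(d^2+a^2)/s^2"
      by (simp add: algebra_simps power2_eq_square add_divide_distrib) 
    also have "\<dots> = d * (d*a^2/s)" 
    proof -
      have "d^2+a^2 = s" by (simp add: s_def)
      then show ?thesis using s by (simp only:) (simp add: power2_eq_square)
    qed
    finally show ?thesis .
  qed
  have e2: "(d^2*a/s)*a = d*(d*a^2/s)" by (simp add: power2_eq_square)
  show "?z \<in> horocycle x d \<inter> geodesic x y" unfolding z using p e e2 assms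
    by (auto simp: mem_horocycle_iff mem_geodesic_iff y algebra_simps power2_eq_square)
  fix w assume "w \<in> horocycle x d \<inter> geodesic x y"
  then have w: "Im w > 0" "(Re w - x)^2 + (Im w)^2 = d * Im w" "(Re w - x)*(Re w - x - a) + (Im w)^2 = 0"
    using assms by (auto simp: mem_horocycle_iff mem_geodesic_iff y algebra_simps)
  define u v where "u = Re w - x" and "v = Im w"
  have 1: "u^2+v^2 = d * v" "u*(u-a)+v^2=0" "v > 0" using w by (auto simp: u_def v_def)
  have ua: "u*a = d * v" using 1 by (simp add: algebra_simps power2_eq_square)
  have "(d * v)^2 + a^2 * v^2 = a^2 * (d * v)" using 1(1) ua by algebra
  then have "v * (v * s) = v * (d*a^2)" by (simp add: s_def power2_eq_square algebra_simps)
  then have v: "v = d*a^2/s" using 1 s by (simp add: field_simps)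
  have "u = d * v/a" using ua a by (simp add: field_simps)
  then have u: "u = d^2*a/s" using a by (simp add: v power2_eq_square)
  show "w = ?z" unfolding z using u v by (simp add: complex_eq_iff u_def v_def)
qed

lemma geodesic_commute: "geodesic x y = geodesic y x" by (auto simp: mem_geodesic_iff mult.commute)

lemma lambda_length_horocycle: assumes "d>0" "e>0" "x \<noteq> y" "d*e \<le> (y-x)^2"
  shows "lambda_length (horocycle x d) (horocycle y e) = \<bar>y-x\<bar> / sqrt (d*e)"
proof -
  define a where "a = y - x"
  have y: "y = x + a" and a: "a \<noteq> 0" using assms by (auto simp: a_def)
  define r where "r = a^2/(d*e)"
  have r: "r \<ge> 1" using assms by (simp add: r_def a_def)
  define s t where "s = a^2+d^2" and "t = a^2+e^2"
  have st: "s > 0" "t>0" using assms by (simp_all add: s_def t_def add_nonneg_pos)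
  have z: "(THE z. z \<in> horocycle x d \<inter> geodesic x y) = Complex (x + d^2*a/s) (d*a^2/s)" (is "?L = ?z")
    using horocycle_meets_geodesic[OF assms(1,3)] by (simp add: a_def s_def)
  have w: "(THE z. z \<in> horocycle y e \<inter> geodesic x y) = Complex (y - e^2*a/t) (e*a^2/t)" (is "?M = ?w")
    using horocycle_meets_geodesic[of e y x] assms by (simp add: a_def t_def geodesic_commute power2_commute) (simp add: algebra_simps diff_divide_distrib)
  have "hyp_dist ?z ?w = arcosh ((r + 1/r)/2)"
  proof -
    have c: "(cmod (?z-?w))^2 = (d^2*a/s + e^2*a/t - a)^2 + (d*a^2/s - e*a^2/t)^2"
      by (simp add: cmod_power2 y algebra_simps)
    have c1: "d^2*a/s + e^2*a/t - a = a*(d^2*e^2 - a^4)/(s*t)"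
      using st by (simp add: field_simps) (simp add: s_def t_def algebra_simps power2_eq_square eval_nat_numeral)
    have c2: "d*a^2/s - e*a^2/t = a^2*(d*e*(e-d) + (d-e)*a^2)/(s*t)"
      using st by (simp add: field_simps) (simp add: s_def t_def algebra_simps power2_eq_square eval_nat_numeral)
    have c3: "(a*(d^2*e^2 - a^4))^2 + (a^2*(d*e*(e-d) + (d-e)*a^2))^2 = a^2 *(a^2-d*e)^2* s*t"
      unfolding s_def t_def by algebra
    have "(cmod (?z-?w))^2 = a^2 *(a^2-d*e)^2 / (s*t)"
      unfolding c c1 c2 power_divide add_divide_distrib[symmetric] c3 using st by (simp add: power2_eq_square)
    then have "1 + (cmod (?z-?w))^2/(2 * Im ?z * Im ?w) = 1 + (a^2-d*e)^2 / (2*d*e*a^2)"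
    proof -
      assume H: "(cmod (?z-?w))^2 = a^2 *(a^2-d*e)^2 / (s*t)"
      have "a^2 *K / (s*t) / (2 * (d*a^2/s) * (e*a^2/t)) = K / (2*d*e*a^2)" for K
        using st a assms(1,2) by (simp add: divide_simps)
      then show ?thesis unfolding H complex.sel by simp
    qed
    also have "\<dots> = (r+1/r)/2" using a assms(1,2) by (simp add: r_def field_simps power2_eq_square)
    finally show ?thesis unfolding hyp_dist_def by (simp only:)
  qed
  also have "(r+1/r)/2 = cosh (ln r)" using r by (simp add: cosh_ln_real inverse_eq_divide)
  also have "arcosh \<dots> = ln r" using r by (simp add: arcosh_cosh_real)
  finally have h: "hyp_dist ?z ?w = ln r" .
  have dis: "horocycle x d \<inter> horocycle y e = {} \<or> r = 1"
  proof (rule disjCI, rule ccontr)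
    assume "r \<noteq> 1" "horocycle x d \<inter> horocycle y e \<noteq> {}"
    then obtain q where "q \<in> horocycle x d" "q \<in> horocycle y e" by blast
    then obtain u v where 1: "u^2+v^2 = d * v" "(u-a)^2+v^2 = e * v" "v>0"
      using assms(1,2) that[of "Re q - x" "Im q"] by (auto simp: mem_horocycle_iff y diff_diff_eq)
    have "a^2 > d*e" using r \<open>r \<noteq> 1\<close> assms(1,2) by (simp add: r_def a_def field_simps order_less_le)
    have f: "u^2 = d * v - v^2" "(a-u)^2 = e * v-v^2" using 1 by (auto simp: power2_commute)
    have "(u*(a-u))^2 = (d * v - v^2)*(e * v-v^2)" using f by (simp add: power_mult_distrib)
    have k: "2*(u*(a-u)) = a^2 - (d+e) * v + 2 * v^2" using f by (simp add: algebra_simps power2_eq_square)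
    have "(a^2 - (d+e) * v + 2 * v^2)^2 = 4*(d * v - v^2)*(e * v-v^2)"
      unfolding k[symmetric] power_mult_distrib[of 2] using \<open>(u*(a-u))^2 = _\<close> by simp
    then have "a^4 + ((d+e) * v)^2 - 2*a^2*(d+e) * v + 4*a^2 * v^2 - 4*d*e * v^2 = 0" by algebra
    then have "(a^2 - (d+e) * v)^2 + 4*(a^2-d*e) * v^2 = 0" by (simp add: algebra_simps power2_eq_square eval_nat_numeral)
    moreover have "4*(a^2-d*e) * v^2 > 0" using \<open>a^2 > d*e\<close> 1 by simp
    ultimately show False by (smt (verit) zero_le_power2)
  qed
  have "signed_dist (horocycle x d) (horocycle y e) = ln r"
    unfolding signed_dist_def Let_def horocycle_center_horocycle[OF assms(1)] horocycle_center_horocycle[OF assms(2)] z w h using dis by auto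
  then have "lambda_length (horocycle x d) (horocycle y e) = exp (ln r/2)" by (simp add: lambda_length_def)
  also have "\<dots> = sqrt r" using r by (intro real_sqrt_unique[symmetric]) (simp_all add: power2_eq_square exp_add[symmetric])
  also have "\<dots> = \<bar>y-x\<bar> / sqrt (d*e)" by (simp add: r_def real_sqrt_divide a_def)
  finally show ?thesis .
qed

lemma lambda_length_farey: fixes p q r s :: int
  assumes "coprime p q" "coprime r s" "q>0" "s>0" "p * s \<noteq> q*r"
  shows "lambda_length (farey_horocycle (of_int p/of_int q)) (farey_horocycle (of_int r/of_int s)) = \<bar>p * s-q*r\<bar>"
proof -
  have q: "quotient_of (of_int p/of_int q) = (p,q)" "quotient_of (of_int r/of_int s) = (r,s)"
    using assms by (simp_all add: Fract_of_int_quotient[symmetric] quotient_of_Fract normalize_def coprime_iff_gcd_eq_1)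
  let ?x = "of_int p/of_int q::real" and ?y = "of_int r/of_int s::real"
  have d: "?y - ?x = - of_int(p * s-q*r)/(of_int q * of_int s)" using assms by (simp add: field_simps)
  have n: "\<bar>p * s-q*r\<bar> \<ge> 1" using assms by simp
  then have n2: "(of_int(p * s-q*r)::real)^2 \<ge> 1" by (metis of_int_1_le_iff of_int_power one_le_power power2_abs)
  have ne: "?x \<noteq> ?y" using d n assms by (metis abs_0 diff_self divide_eq_0_iff mult_eq_0_iff neg_equal_0_iff_equal of_int_eq_0_iff  not_one_le_zero less_irrefl)
  have "lambda_length (farey_horocycle (of_int p/of_int q)) (farey_horocycle (of_int r/of_int s)) = \<bar>?y-?x\<bar> / sqrt ((1/(of_int q)^2)*(1/(of_int s)^2))"
    unfolding farey_horocycle_def q of_rat_divide of_rat_of_int_eq snd_conv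
  proof (rule lambda_length_horocycle[OF _ _ ne])
    show "1 / (real_of_int q)\<^sup>2 * (1 / (real_of_int s)\<^sup>2) \<le> (?y-?x)^2"
    proof -
      have "1 / ((real_of_int q)^2 * (real_of_int s)^2) \<le> (of_int(p * s-q*r))^2 / ((real_of_int q)^2 * (real_of_int s)^2)"
        using n2 by (intro divide_right_mono) auto
      then show ?thesis unfolding d by (simp only: power_divide power_mult_distrib power2_minus) simp
    qed
  qed (use assms in auto)
  also have "\<dots> = \<bar>p * s-q*r\<bar>" unfolding d using assms by (simp add: real_sqrt_mult real_sqrt_divide abs_mult field_simps)
  finally show ?thesis .
qed

end

theory Submission
  imports Defs "HOL-Number_Theory.Cong"
begin

text \<open>
  Represent three rationals \<open>x < y < z\<close> by primitive integer vectors \<open>X = (p, q)\<close>, \<open>Y = (r, s)\<close>,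
  \<open>Z = (u, v)\<close> with positive second entry. The three lambda lengths are then the pairwise
  determinants \<open>a = q r - p s\<close>, \<open>b = u s - r v\<close>, \<open>c = u q - p v\<close>, and the theorem becomes a question
  about which determinants three primitive vectors can have.

  Necessity comes from the linear relation \<open>b X - c Y + a Z = 0\<close>. A common divisor of two of the
  determinants divides the third times a primitive vector, hence divides the third determinant.
  For the parity condition, suppose that \<open>n = gcd a b c\<close> is even and that \<open>a/n\<close>, \<open>b/n\<close>, \<open>c/n\<close> are
  all odd. Modulo 2 the relation divided by \<open>n\<close> says \<open>X + Y + Z = 0\<close>; but all determinants are
  even, and two nonzero vectors over the field with two elements whose determinant vanishes are
  equal, so \<open>X = Y = Z = 0\<close>, against primitivity.

  For sufficiency it is enough to look for triples whose smallest member is \<open>x = 0/1\<close>. Then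
  \<open>a\<close> and \<open>c\<close> have to be the numerators of \<open>y = a/s\<close> and \<open>z = c/v\<close>, and it remains to choose
  denominators \<open>s, v > 0\<close> prime to \<open>a\<close> and \<open>c\<close> with \<open>s c - a v = b\<close>. Write \<open>a = n \<alpha>\<close>,
  \<open>b = n \<beta>\<close>, \<open>c = n \<gamma>\<close>; the divisibility conditions make \<open>\<alpha>, \<beta>, \<gamma>\<close> pairwise coprime, so the
  equation \<open>s \<gamma> - \<alpha> v = \<beta>\<close> has the solutions \<open>s = s0 + \<alpha> t\<close>, \<open>v = v0 + \<gamma> t\<close>, and each of them
  has \<open>s\<close> prime to \<open>\<alpha>\<close> and \<open>v\<close> prime to \<open>\<gamma>\<close>. What is left is to make \<open>s v\<close> prime to \<open>n\<close>.
  Each prime divisor of \<open>n\<close> forbids at most two residues of \<open>t\<close>, one per factor. This always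
  leaves room, except that for the prime 2 the two forbidden residues might exhaust everything;
  the parity condition says exactly that they do not
  (\<open>two_affine_values_nonzero_mod_prime\<close>). The Chinese remainder theorem combines the primes, and
  \<open>t\<close> can be taken large, which makes \<open>s\<close> and \<open>v\<close> positive (\<open>exists_coprime_value\<close>).
\<close>

section \<open>Determinants of three primitive vectors\<close>

lemma dvd_if_dvd_mult_coprime_pair:
  fixes d c r s :: int
  assumes "coprime r s" "d dvd c * r" "d dvd c * s"
  shows "d dvd c"
proof -
  have "d dvd gcd (c * r) (c * s)" using assms by simp
  also have "gcd (c * r) (c * s) = \<bar>c\<bar>"
    using assms(1) by (simp add: gcd_mult_left abs_mult)
  finally show ?thesis by simp
qed

definition chord_arithmetic :: "int \<Rightarrow> int \<Rightarrow> int \<Rightarrow> bool" where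
  "chord_arithmetic a b c \<longleftrightarrow>
     gcd a b dvd c \<and> gcd b c dvd a \<and> gcd a c dvd b \<and>
     (let n = gcd a (gcd b c) in
        even n \<longrightarrow> even (a div n) \<or> even (b div n) \<or> even (c div n))"

text \<open>
  The relation \<open>b X - c Y + a Z = 0\<close> (Cramer's rule) gives the divisibilities over the integers
  and the parity condition over the field with two elements.
\<close>

lemma chord_arithmetic_of_primitive_vectors:
  fixes p q r s u v :: int
  assumes cop: "coprime p q" "coprime r s" "coprime u v"
    and a: "a = q * r - p * s" and b: "b = u * s - r * v" and c: "c = u * q - p * v"
    and "a > 0"
  shows "chord_arithmetic a b c"
proof -
  have rel1: "b * p - c * r + a * u = 0" and rel2: "b * q - c * s + a * v = 0"
    unfolding a b c by (simp_all add: algebra_simps)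
  have e: "c * r = b * p + a * u" "c * s = b * q + a * v"
    "a * u = c * r - b * p" "a * v = c * s - b * q"
    "b * p = c * r - a * u" "b * q = c * s - a * v"
    using rel1 rel2 by simp_all
  have 1: "gcd a b dvd c"
    by (rule dvd_if_dvd_mult_coprime_pair[OF cop(2)]) (simp_all add: e(1,2))
  have 2: "gcd b c dvd a"
    by (rule dvd_if_dvd_mult_coprime_pair[OF cop(3)]) (simp_all add: e(3,4))
  have 3: "gcd a c dvd b"
    by (rule dvd_if_dvd_mult_coprime_pair[OF cop(1)]) (simp_all add: e(5,6))
  define n where "n = gcd a (gcd b c)"
  have n: "n > 0" using \<open>a > 0\<close> by (simp add: n_def)
  have "even (a div n) \<or> even (b div n) \<or> even (c div n)" if "even n"
  proof (rule ccontr)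
    assume odd: "\<not> ?thesis"
    obtain a' b' c' where d: "a = n * a'" "b = n * b'" "c = n * c'"
      by (metis dvdE gcd_dvd1 gcd_dvd2 dvd_trans n_def)
    then have odd': "odd a'" "odd b'" "odd c'" using odd n by auto
    \<comment> \<open>Dividing the relation by \<open>n\<close> makes it informative modulo 2, where all signs vanish.\<close>
    have "n * (b' * p - c' * r + a' * u) = 0" "n * (b' * q - c' * s + a' * v) = 0"
      using rel1 rel2 unfolding d by (simp_all add: algebra_simps)
    then have "b' * p - c' * r + a' * u = 0" "b' * q - c' * s + a' * v = 0"
      using n by simp_all
    then have "even (b' * p - c' * r + a' * u)" "even (b' * q - c' * s + a' * v)"
      by simp_all
    then have sum: "even (p + r + u)" "even (q + s + v)" using odd' by auto
    have "even a" "even b" using that d by simp_all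
    then have dets: "even (q * r - p * s)" "even (u * s - r * v)" by (simp_all add: a b)
    have prim: "odd p \<or> odd q" "odd r \<or> odd s" "odd u \<or> odd v"
      using cop by (meson coprime_common_divisor odd_one)+
    show False using sum dets prim by auto
  qed
  then show ?thesis using 1 2 3 by (simp add: chord_arithmetic_def Let_def n_def)
qed

section \<open>Denominators prime to the numerators\<close>

text \<open>
  A prime cannot divide both \<open>s\<close> and \<open>\<alpha>\<close>, since it would divide \<open>\<beta> = s \<gamma> - \<alpha> v\<close> as well; likewise
  for \<open>v\<close> and \<open>\<gamma>\<close>. Hence each factor vanishes for at most one residue of \<open>t\<close> modulo the prime, and
  three consecutive values of \<open>t\<close> cannot all be bad when the prime is odd. For the prime 2, both
  residues are bad only if \<open>\<alpha>\<close> and \<open>\<gamma>\<close> are odd and \<open>s\<close>, \<open>v\<close> have opposite parities, and then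
  \<open>\<beta>\<close> is odd too.
\<close>

lemma two_affine_values_nonzero_mod_prime:
  fixes \<alpha> \<beta> \<gamma> s v :: int and p :: nat
  assumes p: "prime p"
    and rel: "s * \<gamma> - \<alpha> * v = \<beta>" and "coprime \<alpha> \<beta>" "coprime \<gamma> \<beta>"
    and two: "p = 2 \<Longrightarrow> even \<alpha> \<or> even \<beta> \<or> even \<gamma>"
  shows "\<exists>t::nat. \<not> int p dvd (s + \<alpha> * int t) * (v + \<gamma> * int t)"
proof (rule ccontr)
  assume "\<not> ?thesis"
  then have all: "int p dvd s + \<alpha> * int t \<or> int p dvd v + \<gamma> * int t" for t
    using p by (auto simp: prime_dvd_mult_iff)
  have pp: "prime (int p)" using p by simp
  have nu: "\<not> int p dvd 1" using pp not_prime_unit by blast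
  have not_both: False if "int p dvd x" "int p dvd y" "coprime x y" for x y
    using that nu by (meson coprime_common_divisor)
  have diff: "int p dvd m \<or> int p dvd \<delta>" if "int p dvd w + \<delta> * i" "int p dvd w + \<delta> * j" "i - j = m" for w \<delta> i j m
  proof -
    have "int p dvd (w + \<delta> * i) - (w + \<delta> * j)" using that dvd_diff by blast
    also have "\<dots> = \<delta> * m" using that(3) by (auto simp: algebra_simps)
    finally show ?thesis using pp prime_dvd_mult_iff by blast
  qed
  have no_common: "\<not> (int p dvd s \<and> int p dvd \<alpha>)" "\<not> (int p dvd v \<and> int p dvd \<gamma>)"
    using not_both \<open>coprime \<alpha> \<beta>\<close> \<open>coprime \<gamma> \<beta>\<close> rel by (metis dvd_diff dvd_mult dvd_mult2)+
  show False
  proof (cases "p = 2")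
    case True
    have "even s \<or> even v" "even (s + \<alpha>) \<or> even (v + \<gamma>)"
      using all[of 0] all[of 1] True by simp_all
    moreover have "even (s * \<gamma> - \<alpha> * v) = even \<beta>" using rel by simp
    ultimately show False using no_common two[OF True] True by auto
  next
    case False
    have n2: "\<not> int p dvd 2"
      using p False primes_dvd_imp_eq[of p 2] two_is_prime_nat by (metis int_dvd_int_iff of_nat_numeral)
    have once: False if "int p dvd w + \<delta> * i" "int p dvd w + \<delta> * j" "i - j = 1 \<or> i - j = 2"
      "\<not> (int p dvd w \<and> int p dvd \<delta>)" for w \<delta> i j
    proof -
      have "int p dvd \<delta>" using diff[OF that(1,2) refl] that(3) n2 nu by auto
      then have "int p dvd w" using that(1) by (simp add: dvd_add_left_iff)
      then show False using that(4) \<open>int p dvd \<delta>\<close> by blast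
    qed
    have "int p dvd s + \<alpha> * 0 \<or> int p dvd v + \<gamma> * 0"
      "int p dvd s + \<alpha> * 1 \<or> int p dvd v + \<gamma> * 1"
      "int p dvd s + \<alpha> * 2 \<or> int p dvd v + \<gamma> * 2"
      using all[of 0] all[of 1] all[of 2] by simp_all
    then show False
      using once[of s \<alpha> 1 0] once[of s \<alpha> 2 0] once[of s \<alpha> 2 1]
        once[of v \<gamma> 1 0] once[of v \<gamma> 2 0] once[of v \<gamma> 2 1] no_common by auto
  qed
qed

text \<open>
  A local-to-global principle: a function compatible with congruences, such as a polynomial, takes
  a value prime to \<open>n\<close> as soon as no prime divisor of \<open>n\<close> divides all of its values. The argument
  may be shifted by multiples of \<open>n\<close>, so it can be chosen beyond any bound.
\<close>

lemma exists_coprime_value: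
  fixes f :: "nat \<Rightarrow> int" and n :: int
  assumes "n > 0"
    and cong: "\<And>m x y. [x = y] (mod m) \<Longrightarrow> [f x = f y] (mod int m)"
    and loc: "\<And>p. prime p \<Longrightarrow> int p dvd n \<Longrightarrow> \<exists>t. \<not> int p dvd f t"
  shows "\<exists>t\<ge>N. coprime (f t) n"
proof -
  define A where "A = prime_factors (nat n)"
  have A: "p \<in> A \<longleftrightarrow> prime p \<and> int p dvd n" for p
    using \<open>n > 0\<close> by (auto simp: A_def in_prime_factors_iff nat_dvd_iff int_dvd_int_iff[symmetric] simp del: int_dvd_int_iff)
  then have "\<forall>p\<in>A. \<exists>t. \<not> int p dvd f t" using loc by blast
  then obtain g where g: "\<And>p. p \<in> A \<Longrightarrow> \<not> int p dvd f (g p)" by metis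
  have "\<forall>i\<in>A. \<forall>j\<in>A. i \<noteq> j \<longrightarrow> coprime i j" using A by (auto intro: primes_coprime)
  then obtain x where x: "\<And>p. p \<in> A \<Longrightarrow> [x = g p] (mod p)"
    using chinese_remainder_nat[of A "\<lambda>p. p" g] by (auto simp: A_def)
  define t where "t = x + N * nat n"
  have not_dvd: "\<not> int p dvd f t" if "p \<in> A" for p
  proof -
    have "p dvd N * nat n" using A that \<open>n > 0\<close> by (simp add: nat_dvd_iff int_dvd_int_iff[symmetric] del: int_dvd_int_iff)
    then obtain k where "N * nat n = p * k" by (rule dvdE)
    then have "[t = x] (mod p)" unfolding t_def by (simp add: cong_def)
    then have "[t = g p] (mod p)" using x[OF that] cong_trans by blast
    then have "[f t = f (g p)] (mod int p)" by (rule cong)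
    then show ?thesis using g[OF that] cong_dvd_iff by blast
  qed
  have "coprime (f t) n"
  proof (rule ccontr)
    assume "\<not> ?thesis"
    then have "gcd (f t) n \<noteq> 1" by (simp add: coprime_iff_gcd_eq_1)
    then have "nat (gcd (f t) n) \<noteq> 1" by simp
    then obtain p where p: "prime p" "p dvd nat (gcd (f t) n)" using prime_factor_nat by blast
    then have "int p dvd gcd (f t) n" by (simp add: nat_dvd_iff flip: int_dvd_int_iff)
    then show False using A[of p] p(1) not_dvd[of p] by simp
  qed
  moreover have "1 \<le> nat n" using \<open>n > 0\<close> by simp
  then have "N * 1 \<le> N * nat n" by (rule mult_le_mono2)
  then have "t \<ge> N" unfolding t_def by linarith
  ultimately show ?thesis by blast
qed

text \<open>
  The vectors produced are \<open>(0, 1)\<close>, \<open>(a, s)\<close> and \<open>(c, v)\<close>: the determinants with the first one are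
  \<open>a\<close> and \<open>c\<close> automatically, so only the third determinant and primitivity remain to be arranged.
\<close>

lemma primitive_vectors_of_chord_arithmetic:
  fixes a b c :: int
  assumes pos: "a > 0" "b > 0" "c > 0" and arith: "chord_arithmetic a b c"
  obtains s v where "s > 0" "v > 0" "coprime a s" "coprime c v" "s * c - a * v = b"
proof -
  define n where "n = gcd a (gcd b c)"
  have n: "n > 0" using pos by (simp add: n_def)
  obtain \<alpha> \<beta> \<gamma> where d: "a = n * \<alpha>" "b = n * \<beta>" "c = n * \<gamma>"
    by (metis dvdE gcd_dvd1 gcd_dvd2 dvd_trans n_def)
  have pos': "\<alpha> > 0" "\<beta> > 0" "\<gamma> > 0" using pos n d by (simp_all add: zero_less_mult_iff)
  have "gcd a b dvd n" "gcd b c dvd n" "gcd a c dvd n"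
    using arith by (auto simp: chord_arithmetic_def n_def intro: dvd_trans[OF gcd_dvd1] dvd_trans[OF gcd_dvd2])
  then have "n * gcd \<alpha> \<beta> dvd n * 1" "n * gcd \<beta> \<gamma> dvd n * 1" "n * gcd \<alpha> \<gamma> dvd n * 1"
    unfolding d gcd_mult_left using n by (simp_all add: abs_mult)
  then have cop: "coprime \<alpha> \<beta>" "coprime \<gamma> \<beta>" "coprime \<alpha> \<gamma>"
    using n by (simp_all add: coprime_iff_gcd_eq_1 gcd.commute)
  have par: "even n \<Longrightarrow> even \<alpha> \<or> even \<beta> \<or> even \<gamma>"
    using arith n unfolding chord_arithmetic_def Let_def n_def[symmetric] by (simp add: d)
  obtain x y where "x * \<alpha> + y * \<gamma> = 1"
    using cop(3) bezout_int[of \<alpha> \<gamma>] by auto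
  moreover have "(\<beta> * y) * \<gamma> - \<alpha> * (- (\<beta> * x)) = \<beta> * (x * \<alpha> + y * \<gamma>)"
    by (simp add: algebra_simps)
  ultimately obtain s0 v0 where rel0: "s0 * \<gamma> - \<alpha> * v0 = \<beta>" by (metis mult.right_neutral)
  define f where "f t = (s0 + \<alpha> * int t) * (v0 + \<gamma> * int t)" for t
  \<comment> \<open>For \<open>t \<ge> N\<close> the steps \<open>\<alpha> t\<close> and \<open>\<gamma> t\<close> outweigh negative \<open>s0\<close> and \<open>v0\<close>.\<close>
  define N where "N = nat (\<bar>s0\<bar> + \<bar>v0\<bar> + 1)"
  have "\<exists>t\<ge>N. coprime (f t) n"
  proof (rule exists_coprime_value[OF n])
    fix m x y :: nat assume "[x = y] (mod m)"
    then have "[int x = int y] (mod int m)" by (simp add: cong_int_iff)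
    then show "[f x = f y] (mod int m)"
      unfolding f_def by (intro cong_mult cong_add cong_refl)
  next
    fix p :: nat assume "prime p" "int p dvd n"
    then show "\<exists>t. \<not> int p dvd f t" unfolding f_def
      using cop rel0 par by (intro two_affine_values_nonzero_mod_prime) auto
  qed
  then obtain t where t: "t \<ge> N" "coprime (f t) n" by blast
  define s v where "s = s0 + \<alpha> * int t" and "v = v0 + \<gamma> * int t"
  have rel: "s * \<gamma> - \<alpha> * v = \<beta>" using rel0 by (simp add: s_def v_def algebra_simps)
  have tn: "int t \<ge> \<bar>s0\<bar> + \<bar>v0\<bar> + 1" using t(1) by (simp add: N_def)
  have "\<alpha> * int t \<ge> 1 * int t" "\<gamma> * int t \<ge> 1 * int t"
    using pos' by (intro mult_right_mono; simp)+
  then have sv: "s > 0" "v > 0" using tn by (simp_all add: s_def v_def)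
  have "coprime (s * v) n" using t(2) by (simp add: f_def s_def v_def)
  then have svn: "coprime s n" "coprime v n" by simp_all
  have "coprime \<alpha> s"
  proof (rule coprimeI)
    fix k assume "k dvd \<alpha>" "k dvd s"
    then have "k dvd s * \<gamma> - \<alpha> * v" by simp
    then show "is_unit k" using cop(1) rel \<open>k dvd \<alpha>\<close> by (metis coprime_common_divisor)
  qed
  moreover have "coprime \<gamma> v"
  proof (rule coprimeI)
    fix k assume "k dvd \<gamma>" "k dvd v"
    then have "k dvd s * \<gamma> - \<alpha> * v" by simp
    then show "is_unit k" using cop(2) rel \<open>k dvd \<gamma>\<close> by (metis coprime_common_divisor)
  qed
  ultimately have "coprime a s" "coprime c v" using svn by (simp_all add: d coprime_commute)
  moreover have "s * c - a * v = b" using arg_cong[OF rel, of "\<lambda>z. n * z"] by (simp add: d algebra_simps)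
  ultimately show ?thesis using that sv by blast
qed

section \<open>Triangular chords\<close>

lemma triangular_chord_iff_chord_arithmetic:
  "triangular_chord M \<longleftrightarrow>
    (\<exists>a b c :: int. a > 0 \<and> b > 0 \<and> c > 0 \<and> chord_arithmetic a b c \<and>
       M = {# real_of_int a, real_of_int b, real_of_int c #})" (is "_ \<longleftrightarrow> ?R")
proof
  assume "triangular_chord M"
  then obtain x y z where xyz: "x < y" "y < z"
    and M: "M = {# lambda_length (farey_horocycle x) (farey_horocycle y),
               lambda_length (farey_horocycle y) (farey_horocycle z),
               lambda_length (farey_horocycle x) (farey_horocycle z) #}"
    unfolding triangular_chord_def by blast
  have reduced: "\<exists>p q. w = of_int p / of_int q \<and> q > 0 \<and> coprime p q" for w :: rat
    by (metis quotient_of_div quotient_of_denom_pos quotient_of_coprime prod.exhaust)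
  obtain p q where x: "x = of_int p / of_int q" "q > 0" "coprime p q" using reduced by blast
  obtain r s where y: "y = of_int r / of_int s" "s > 0" "coprime r s" using reduced by blast
  obtain u v where z: "z = of_int u / of_int v" "v > 0" "coprime u v" using reduced by blast
  have less: "i * l < k * j" if "(of_int i / of_int j :: rat) < of_int k / of_int l" "j > 0" "l > 0" for i j k l :: int
  proof -
    have "(of_int (i * l) :: rat) < of_int (k * j)" using that by (simp add: field_simps)
    then show ?thesis by (simp only: of_int_less_iff)
  qed
  have xy: "p * s < r * q" and yz: "r * v < u * s" and xz: "p * v < u * q"
    using less xyz x y z order.strict_trans[OF xyz] by auto
  have "M = {# real_of_int (q * r - p * s), real_of_int (u * s - r * v), real_of_int (u * q - p * v) #}"
    unfolding M x(1) y(1) z(1)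
    using xy yz xz x y z by (simp add: lambda_length_farey algebra_simps)
  moreover have "chord_arithmetic (q * r - p * s) (u * s - r * v) (u * q - p * v)"
    using x(3) y(3) z(3) xy
    by (intro chord_arithmetic_of_primitive_vectors[of p q r s u v]) (auto simp: mult.commute)
  ultimately show ?R using xy yz xz
    by (intro exI[of _ "q * r - p * s"] exI[of _ "u * s - r * v"] exI[of _ "u * q - p * v"])
       (simp add: mult.commute)
next
  assume ?R
  then obtain a b c :: int where pos: "a > 0" "b > 0" "c > 0" and ar: "chord_arithmetic a b c"
    and M: "M = {# real_of_int a, real_of_int b, real_of_int c #}" by blast
  obtain s v where sv: "s > 0" "v > 0" "coprime a s" "coprime c v" "s * c - a * v = b"
    using primitive_vectors_of_chord_arithmetic[OF pos ar] .
  let ?x = "of_int 0 / of_int 1 :: rat" and ?y = "of_int a / of_int s :: rat"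
    and ?z = "of_int c / of_int v :: rat"
  have "?x < ?y" using pos sv by simp
  moreover have "?y < ?z"
  proof -
    have "of_int (a * v) < (of_int (c * s) :: rat)"
      unfolding of_int_less_iff using sv(5) pos by (simp add: mult.commute)
    then show ?thesis using sv by (simp add: field_simps)
  qed
  moreover have "M = {# lambda_length (farey_horocycle ?x) (farey_horocycle ?y),
               lambda_length (farey_horocycle ?y) (farey_horocycle ?z),
               lambda_length (farey_horocycle ?x) (farey_horocycle ?z) #}"
  proof -
    have "lambda_length (farey_horocycle ?x) (farey_horocycle ?y) = of_int a"
      by (subst lambda_length_farey) (use pos sv in simp_all)
    moreover have "lambda_length (farey_horocycle ?x) (farey_horocycle ?z) = of_int c"
      by (subst lambda_length_farey) (use pos sv in simp_all)
    moreover have "\<bar>a * v - s * c\<bar> = b" "a * v \<noteq> s * c" using sv(5) pos by simp_all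
    then have "lambda_length (farey_horocycle ?y) (farey_horocycle ?z) = of_int b"
      by (subst lambda_length_farey) (use sv in simp_all)
    ultimately show ?thesis by (simp only: M)
  qed
  ultimately show "triangular_chord M" unfolding triangular_chord_def by blast
qed

text \<open>
  A multiset does not record which of its members is the length between the outer two horocycles.
  This is harmless because the arithmetic condition is symmetric; the two transpositions below
  generate all permutations.
\<close>

lemma chord_arithmetic_swap:
  "chord_arithmetic b a c \<longleftrightarrow> chord_arithmetic a b c"
  "chord_arithmetic a c b \<longleftrightarrow> chord_arithmetic a b c"
  unfolding chord_arithmetic_def Let_def
    gcd.commute[of b a] gcd.commute[of c b] gcd.left_commute[of b a c]
  by blast+

lemma chord_arithmetic_cong_mset:
  assumes "{# a, b, c #} = {# a', b', c' #}"
  shows "chord_arithmetic a b c \<longleftrightarrow> chord_arithmetic a' b' c'"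
proof -
  have "(a', b', c') \<in> {(a, b, c), (a, c, b), (b, a, c), (b, c, a), (c, a, b), (c, b, a)}"
    using assms by (auto simp: add_eq_conv_ex)
  moreover have "chord_arithmetic a c b \<longleftrightarrow> chord_arithmetic a b c"
    "chord_arithmetic b a c \<longleftrightarrow> chord_arithmetic a b c"
    "chord_arithmetic b c a \<longleftrightarrow> chord_arithmetic a b c"
    "chord_arithmetic c a b \<longleftrightarrow> chord_arithmetic a b c"
    "chord_arithmetic c b a \<longleftrightarrow> chord_arithmetic a b c"
    using chord_arithmetic_swap by blast+
  ultimately show ?thesis by fastforce
qed

theorem theorem2p5:
  fixes l :: "nat \<Rightarrow> nat"
  assumes "\<And>i. i \<in> {1, 2, 3} \<Longrightarrow> 0 < l i"
  shows "triangular_chord {# real (l 1), real (l 2), real (l 3) #} \<longleftrightarrow>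
           (\<forall>i j k. {i, j, k} = {1, 2, 3} \<longrightarrow> gcd (l i) (l j) dvd l k) \<and>
           (let n = Gcd {l 1, l 2, l 3}
            in even n \<longrightarrow> (\<exists>i\<in>{1, 2, 3}. even (l i div n)))"
proof -
  let ?a = "int (l 1)" and ?b = "int (l 2)" and ?c = "int (l 3)"
  have "triangular_chord {# real (l 1), real (l 2), real (l 3) #} \<longleftrightarrow> chord_arithmetic ?a ?b ?c"
  proof
    assume "triangular_chord {# real (l 1), real (l 2), real (l 3) #}"
    then obtain a b c where ar: "chord_arithmetic a b c"
      and M: "{# real (l 1), real (l 2), real (l 3) #} = {# real_of_int a, real_of_int b, real_of_int c #}"
      unfolding triangular_chord_iff_chord_arithmetic by blast
    have "image_mset real_of_int {# ?a, ?b, ?c #} = image_mset real_of_int {# a, b, c #}"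
      using M by simp
    then have "{# ?a, ?b, ?c #} = {# a, b, c #}"
      by (rule injD[OF multiset.inj_map, rotated]) (simp add: inj_def)
    then show "chord_arithmetic ?a ?b ?c" using ar chord_arithmetic_cong_mset by blast
  next
    assume "chord_arithmetic ?a ?b ?c"
    moreover have "?a > 0" "?b > 0" "?c > 0" using assms by simp_all
    ultimately show "triangular_chord {# real (l 1), real (l 2), real (l 3) #}"
      unfolding triangular_chord_iff_chord_arithmetic
      by (intro exI[of _ ?a] exI[of _ ?b] exI[of _ ?c]) simp
  qed
  moreover have "(\<forall>i j k. {i, j, k} = {1, 2, 3} \<longrightarrow> gcd (l i) (l j) dvd l k) \<longleftrightarrow>
      gcd (l 1) (l 2) dvd l 3 \<and> gcd (l 2) (l 3) dvd l 1 \<and> gcd (l 1) (l 3) dvd l 2" (is "?L \<longleftrightarrow> ?R")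
  proof
    assume L: ?L
    have "{1, 2, 3} = {1, 2, 3::nat}" "{2, 3, 1} = {1, 2, 3::nat}" "{1, 3, 2} = {1, 2, 3::nat}" by auto
    then show ?R using L by blast
  next
    assume R: ?R
    show ?L
    proof (intro allI impI)
      fix i j k :: nat assume e: "{i, j, k} = {1, 2, 3}"
      have "(i = 1 \<and> j = 2 \<and> k = 3) \<or> (i = 2 \<and> j = 1 \<and> k = 3) \<or>
          (i = 2 \<and> j = 3 \<and> k = 1) \<or> (i = 3 \<and> j = 2 \<and> k = 1) \<or>
          (i = 1 \<and> j = 3 \<and> k = 2) \<or> (i = 3 \<and> j = 1 \<and> k = 2)"
        using e unfolding set_eq_iff insert_iff empty_iff
        by (metis one_eq_numeral_iff numeral_eq_iff num.distinct num.inject)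
      then show "gcd (l i) (l j) dvd l k"
        using R by (elim disjE conjE) (simp_all only: gcd.commute)
    qed
  qed
  moreover have "Gcd {l 1, l 2, l 3} = gcd (l 1) (gcd (l 2) (l 3))" by simp
  ultimately show ?thesis
    by (simp add: chord_arithmetic_def Let_def gcd_int_int_eq zdiv_int[symmetric])
qed

end
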